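(* For all $n\ge1$, the edge connectivity of the parity-constrained Hanoi graph satisfies $\lambda(P^n)=2$.
   Context: Let $Q=\{0,1,2,3\}$ (pegs: $0,3$ neutral; $1$ reserved for even discs; $2$ reserved for odd discs). For a disc $d\in\{1,\dots,n\}$ let $p(d)=1$ if $d$ is even and $p(d)=2$ if $d$ is odd, and $Q^d=\{0,p(d),3\}$. The vertices of $P^n$ are words $s=s_n\cdots s_1\in Q^n$ ($s_d$ is the peg of disc $d$) with $s_d\in Q^d$ for all $d$. Two vertices are adjacent iff they differ in exactly one coordinate $d$, with values $i\ne j$ there, $i,j\in Q^d$, and $s_k\notin\{i,j\}$ for all $k<d$. *)

theory Defs
  imports "Graph_Theory.Digraph_Component" "HOL-Library.FuncSet"
begin

text \<open>Edge connectivity. As in \<^theory>\<open>Graph_Theory.Digraph\<close>, an undirected graph is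
  a symmetric digraph; an edge is the two-element set of its ends, so that the two opposite arcs
  on it count as one edge and are deleted together.\<close>

definition edges :: "'a pair_pre_digraph \<Rightarrow> 'a set set" where
  "edges G = {{u, v} |u v. (u, v) \<in> parcs G}"

definition delete_edges :: "'a pair_pre_digraph \<Rightarrow> 'a set set \<Rightarrow> 'a pair_pre_digraph" where
  "delete_edges G F = \<lparr>pverts = pverts G, parcs = {(u, v) \<in> parcs G. {u, v} \<notin> F}\<rparr>"

text \<open>A graph with a single vertex cannot be disconnected; there the infimum is over the empty
  set of naturals and is \<open>0\<close>, the usual convention.\<close>

definition edge_connectivity :: "'a pair_pre_digraph \<Rightarrow> nat" where
  "edge_connectivity G =
     Inf {card F |F. finite F \<and> F \<subseteq> edges G \<and> \<not> connected (with_proj (delete_edges G F))}"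

definition reserved_peg :: "nat \<Rightarrow> nat" where
  "reserved_peg d = (if even d then 1 else 2)"

definition disc_pegs :: "nat \<Rightarrow> nat set" where
  "disc_pegs d = {0, reserved_peg d, 3}"

text \<open>The word \<open>s\<^sub>n \<dots> s\<^sub>1\<close> is the function \<open>d \<mapsto> s\<^sub>d\<close> on \<open>{1..n}\<close>, \<open>undefined\<close> elsewhere.\<close>

definition parity_hanoi_states :: "nat \<Rightarrow> (nat \<Rightarrow> nat) set" where
  "parity_hanoi_states n = (\<Pi>\<^sub>E d\<in>{1..n}. disc_pegs d)"

definition parity_hanoi_adj :: "nat \<Rightarrow> (nat \<Rightarrow> nat) \<Rightarrow> (nat \<Rightarrow> nat) \<Rightarrow> bool" where
  "parity_hanoi_adj n s t \<longleftrightarrow>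
     (\<exists>d\<in>{1..n}. \<exists>i\<in>disc_pegs d. \<exists>j\<in>disc_pegs d.
        i \<noteq> j \<and> s d = i \<and> t d = j \<and>
        (\<forall>k\<in>{1..n} - {d}. s k = t k) \<and>
        (\<forall>k\<in>{1..<d}. s k \<notin> {i, j}))"

definition parity_hanoi_graph :: "nat \<Rightarrow> (nat \<Rightarrow> nat) pair_pre_digraph" where
  "parity_hanoi_graph n =
     \<lparr>pverts = parity_hanoi_states n,
      parcs = {(s, t). s \<in> parity_hanoi_states n \<and> t \<in> parity_hanoi_states n \<and>
                       parity_hanoi_adj n s t}\<rparr>"

lemma parity_hanoi_adj_sym:
  assumes "parity_hanoi_adj n s t"
  shows "parity_hanoi_adj n t s"
proof -
  from assms obtain d where d: "d \<in> {1..n}" "s d \<in> disc_pegs d" "t d \<in> disc_pegs d" "s d \<noteq> t d"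
    and eq: "\<forall>k\<in>{1..n} - {d}. s k = t k" and free: "\<forall>k\<in>{1..<d}. s k \<notin> {s d, t d}"
    unfolding parity_hanoi_adj_def by blast
  have "t k \<notin> {t d, s d}" if "k \<in> {1..<d}" for k
  proof -
    have "k \<in> {1..n} - {d}" using that d(1) by auto
    then have "s k = t k" using eq by blast
    then show ?thesis using free that by auto
  qed
  then show ?thesis
    unfolding parity_hanoi_adj_def using d eq by (metis (no_types, lifting))
qed

lemma pair_graph_parity_hanoi_graph: "pair_graph (parity_hanoi_graph n)"
proof
  show fin: "finite (pverts (parity_hanoi_graph n))"
    by (auto simp: parity_hanoi_graph_def parity_hanoi_states_def disc_pegs_def intro: finite_PiE)
  have "parcs (parity_hanoi_graph n)
      \<subseteq> pverts (parity_hanoi_graph n) \<times> pverts (parity_hanoi_graph n)"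
    by (auto simp: parity_hanoi_graph_def)
  then show "finite (parcs (parity_hanoi_graph n))"
    using fin finite_subset by blast
  show "symmetric (with_proj (parity_hanoi_graph n))"
    by (auto simp: symmetric_def sym_def parity_hanoi_graph_def parity_hanoi_adj_sym)
qed (auto simp: parity_hanoi_graph_def parity_hanoi_adj_def)

end

theory Submission
  imports Defs
begin

text \<open>The states of \<open>P\<^sup>m\<^sup>+\<^sup>1\<close> with the largest disc on a given peg form a copy of \<open>P\<^sup>m\<close>, and any
  two of the three copies are joined by an edge, since every smaller disc has a peg outside the two
  pegs that the largest disc uses. Inductively, each copy stays connected after the removal of one
  edge, and the triangle of copies stays connected when one of its links is lost; so \<open>P\<^sup>n\<close> has no
  bridge. Conversely, with all discs on peg \<open>0\<close> only disc \<open>1\<close> can move, so this state has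
  degree \<open>2\<close>.\<close>

text \<open>Reduces connectedness to plain reachability. \<open>connected\<close> passes to the
  symmetric closure, which adds nothing here: arcs come in opposite pairs, and deleting an edge
  removes both. Restricting walks to vertices changes nothing either, since every arc ends in a
  vertex.\<close>

lemma connected_delete_edges_iff:
  assumes "pair_graph G"
  shows "connected (with_proj (delete_edges G F)) \<longleftrightarrow>
    pverts G \<noteq> {} \<and>
    (\<forall>u\<in>pverts G. \<forall>v\<in>pverts G. (u, v) \<in> {(u, v) \<in> parcs G. {u, v} \<notin> F}\<^sup>*)"
proof -
  interpret pair_graph G by fact
  let ?R = "{(u, v) \<in> parcs G. {u, v} \<notin> F}"
  have sym: "(v, u) \<in> parcs G" if "(u, v) \<in> parcs G" for u v
    using sym_arcs that by (auto simp: symmetric_def sym_def)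
  have parcs_eq: "parcs (mk_symmetric (with_proj (delete_edges G F))) = ?R"
    by (auto simp: parcs_mk_symmetric delete_edges_def insert_commute sym)
  have wf: "v \<in> pverts G" if "(u, v) \<in> ?R" for u v
    using that in_arcsD2 by auto
  have "(u, v) \<in> rtrancl_on (pverts G) ?R \<longleftrightarrow> (u, v) \<in> ?R\<^sup>*" if "u \<in> pverts G" for u v
  proof
    assume "(u, v) \<in> ?R\<^sup>*"
    then show "(u, v) \<in> rtrancl_on (pverts G) ?R"
      by induction (use that wf in \<open>auto intro: rtrancl_on_into_rtrancl_on\<close>)
  qed (rule rtrancl_on_rtranclI)
  moreover have "pverts (delete_edges G F) = pverts G"
    by (simp add: delete_edges_def)
  ultimately show ?thesis
    by (simp add: connected_def strongly_connected_def reachable_def parcs_eq)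
qed

lemma edge_connectivity_eqI:
  assumes "finite F" "F \<subseteq> edges G" "\<not> connected (with_proj (delete_edges G F))"
    and "\<And>F'. finite F' \<Longrightarrow> F' \<subseteq> edges G \<Longrightarrow> \<not> connected (with_proj (delete_edges G F')) \<Longrightarrow>
      card F \<le> card F'"
  shows "edge_connectivity G = card F"
  unfolding edge_connectivity_def using assms by (intro cInf_eq_minimum) blast+

lemma reserved_peg_cases: "reserved_peg d = 1 \<or> reserved_peg d = 2"
  by (simp add: reserved_peg_def)

lemma disc_pegs_other:
  obtains p where "p \<in> disc_pegs d" "p \<noteq> a" "p \<noteq> b"
proof -
  have "card (disc_pegs d) = 3"
    using reserved_peg_cases[of d] by (auto simp: disc_pegs_def)
  moreover have "card {a, b} \<le> 2"
    by (simp add: card_insert_if)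
  ultimately have "\<not> disc_pegs d \<subseteq> {a, b}"
    using card_mono[of "{a, b}" "disc_pegs d"] by auto
  then show thesis
    using that by auto
qed

text \<open>Each disc has three pegs, so at least one lies outside \<open>{a, b}\<close>. With the
  smaller discs placed this way, the largest one is free to move between \<open>a\<close> and
  \<open>b\<close>.\<close>

lemma parity_hanoi_state_avoiding:
  obtains g where "g \<in> parity_hanoi_states m" "\<And>k. k \<in> {1..m} \<Longrightarrow> g k \<notin> {a, b}"
proof -
  have "\<exists>p. p \<in> disc_pegs d \<and> p \<noteq> a \<and> p \<noteq> b" for d
    using disc_pegs_other by metis
  then obtain f where "\<And>d. f d \<in> disc_pegs d \<and> f d \<noteq> a \<and> f d \<noteq> b"
    by metis
  then show thesis
    by (intro that[of "restrict f {1..m}"]) (auto simp: parity_hanoi_states_def)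
qed

lemma parity_hanoi_states_update:
  assumes "s \<in> parity_hanoi_states m" "a \<in> disc_pegs (Suc m)"
  shows "s(Suc m := a) \<in> parity_hanoi_states (Suc m)"
  using assms by (auto simp: parity_hanoi_states_def PiE_iff extensional_def le_Suc_eq)

lemma parity_hanoi_states_SucE:
  assumes "s \<in> parity_hanoi_states (Suc m)"
  obtains t a where "t \<in> parity_hanoi_states m" "a \<in> disc_pegs (Suc m)" "s = t(Suc m := a)"
proof
  show "s(Suc m := undefined) \<in> parity_hanoi_states m"
    using assms by (auto simp: parity_hanoi_states_def PiE_iff extensional_def)
  show "s (Suc m) \<in> disc_pegs (Suc m)"
    using assms by (auto simp: parity_hanoi_states_def)
  show "s = (s(Suc m := undefined))(Suc m := s (Suc m))"
    by simp
qed

text \<open>Only smaller discs can block a move, so an extra largest disc resting on a fixed peg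
  keeps it legal.\<close>

lemma parity_hanoi_adj_copy:
  assumes "parity_hanoi_adj m s t"
  shows "parity_hanoi_adj (Suc m) (s(Suc m := a)) (t(Suc m := a))"
proof -
  obtain d where d: "d \<in> {1..m}" "s d \<in> disc_pegs d" "t d \<in> disc_pegs d" "s d \<noteq> t d"
    "\<forall>k\<in>{1..m} - {d}. s k = t k" "\<forall>k\<in>{1..<d}. s k \<notin> {s d, t d}"
    using assms unfolding parity_hanoi_adj_def by blast
  then show ?thesis
    unfolding parity_hanoi_adj_def by (intro bexI[of _ d] bexI[of _ "s d"] bexI[of _ "t d"]) auto
qed

lemma parity_hanoi_adj_link:
  assumes "a \<in> disc_pegs (Suc m)" "b \<in> disc_pegs (Suc m)" "a \<noteq> b"
    and "\<And>k. k \<in> {1..m} \<Longrightarrow> s k \<notin> {a, b}"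
  shows "parity_hanoi_adj (Suc m) (s(Suc m := a)) (s(Suc m := b))"
  unfolding parity_hanoi_adj_def using assms
  by (intro bexI[of _ "Suc m"] bexI[of _ a] bexI[of _ b]) auto

text \<open>Here \<open>e\<close> is any set of states: the induction below replaces it by an image
  that need not be an edge.\<close>

definition hanoi_arcs_minus :: "nat \<Rightarrow> (nat \<Rightarrow> nat) set \<Rightarrow> ((nat \<Rightarrow> nat) \<times> (nat \<Rightarrow> nat)) set" where
  "hanoi_arcs_minus n e = {(s, t) \<in> parcs (parity_hanoi_graph n). {s, t} \<noteq> e}"

lemma hanoi_arcs_minus_iff:
  "(s, t) \<in> hanoi_arcs_minus n e \<longleftrightarrow>
    s \<in> parity_hanoi_states n \<and> t \<in> parity_hanoi_states n \<and> parity_hanoi_adj n s t \<and> {s, t} \<noteq> e"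
  by (auto simp: hanoi_arcs_minus_def parity_hanoi_graph_def)

lemma parity_hanoi_bridgeless:
  assumes "s \<in> parity_hanoi_states n" "t \<in> parity_hanoi_states n"
  shows "(s, t) \<in> (hanoi_arcs_minus n e)\<^sup>*"
  using assms
proof (induction n arbitrary: s t e)
  case 0
  then show ?case
    by (simp add: parity_hanoi_states_def)
next
  case (Suc m)
  let ?R = "hanoi_arcs_minus (Suc m) e"
  \<comment> \<open>The projection of \<open>e\<close> that forgets the largest disc. It serves all
    three copies at once: an edge inside one copy is dropped from each of them, while a link
    collapses to a singleton, which is no edge.\<close>
  let ?e' = "(\<lambda>u. u(Suc m := undefined)) ` e"
  have step: "(u(Suc m := a), v(Suc m := a)) \<in> ?R"
    if "(u, v) \<in> hanoi_arcs_minus m ?e'" "a \<in> disc_pegs (Suc m)" for u v a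
  proof -
    have uv: "u \<in> parity_hanoi_states m" "v \<in> parity_hanoi_states m" "parity_hanoi_adj m u v"
      "{u, v} \<noteq> ?e'"
      using that(1) by (auto simp: hanoi_arcs_minus_iff)
    \<comment> \<open>States of the \<open>m\<close> smaller discs are already
      \<open>undefined\<close> at \<open>Suc m\<close>; so if the lifted pair were \<open>e\<close>,
      projecting would give \<open>{u, v} = ?e'\<close>.\<close>
    have "u(Suc m := undefined) = u" "v(Suc m := undefined) = v"
      using uv(1,2) by (auto simp: parity_hanoi_states_def PiE_iff extensional_def)
    then have "{u(Suc m := a), v(Suc m := a)} \<noteq> e"
      using uv(4) by auto
    then show ?thesis
      using uv that(2)
      by (simp add: hanoi_arcs_minus_iff parity_hanoi_states_update parity_hanoi_adj_copy)
  qed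
  have copy: "(u(Suc m := a), v(Suc m := a)) \<in> ?R\<^sup>*"
    if "u \<in> parity_hanoi_states m" "v \<in> parity_hanoi_states m" "a \<in> disc_pegs (Suc m)" for u v a
    using Suc.IH[OF that(1,2), of ?e']
    by induction (blast intro: rtrancl.rtrancl_into_rtrancl step that(3))+
  \<comment> \<open>Walk to \<open>g\<close> inside copy \<open>a\<close>, move the largest disc,
    and walk on inside copy \<open>b\<close>.\<close>
  have via_link: "(u(Suc m := a), v(Suc m := b)) \<in> ?R\<^sup>*"
    if "u \<in> parity_hanoi_states m" "v \<in> parity_hanoi_states m" "g \<in> parity_hanoi_states m"
      "a \<in> disc_pegs (Suc m)" "b \<in> disc_pegs (Suc m)" "a \<noteq> b"
      "\<And>k. k \<in> {1..m} \<Longrightarrow> g k \<notin> {a, b}" "{g(Suc m := a), g(Suc m := b)} \<noteq> e" for u v g a b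
  proof -
    have "(g(Suc m := a), g(Suc m := b)) \<in> ?R"
      unfolding hanoi_arcs_minus_iff
      using that(3-8) by (intro conjI parity_hanoi_states_update parity_hanoi_adj_link) blast+
    then show ?thesis
      using copy[of u g a] copy[of g v b] that by (meson rtrancl.rtrancl_into_rtrancl rtrancl_trans)
  qed
  \<comment> \<open>A link records its two pegs as the values at the largest disc, so \<open>e\<close> is a link for at
    most one pair of pegs.\<close>
  have via_other: "(u(Suc m := a), v(Suc m := b)) \<in> ?R\<^sup>*"
    if "u \<in> parity_hanoi_states m" "v \<in> parity_hanoi_states m"
      "a \<in> disc_pegs (Suc m)" "b \<in> disc_pegs (Suc m)" "a \<noteq> b"
      "(\<lambda>w. w (Suc m)) ` e \<noteq> {a, b}" for u v a b
  proof -
    obtain g where g: "g \<in> parity_hanoi_states m" "\<And>k. k \<in> {1..m} \<Longrightarrow> g k \<notin> {a, b}"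
      using parity_hanoi_state_avoiding by blast
    have "{g(Suc m := a), g(Suc m := b)} \<noteq> e"
      using that(6) by auto
    then show ?thesis
      using via_link that g by blast
  qed
  have cross: "(u(Suc m := a), v(Suc m := b)) \<in> ?R\<^sup>*"
    if "u \<in> parity_hanoi_states m" "v \<in> parity_hanoi_states m"
      "a \<in> disc_pegs (Suc m)" "b \<in> disc_pegs (Suc m)" "a \<noteq> b" for u v a b
  proof (cases "(\<lambda>w. w (Suc m)) ` e = {a, b}")
    case True
    \<comment> \<open>If \<open>e\<close> may be a link between \<open>a\<close> and
      \<open>b\<close>, detour through the copy on the third peg \<open>c\<close>; neither of the
      two pairs used is \<open>{a, b}\<close>.\<close>
    obtain c where c: "c \<in> disc_pegs (Suc m)" "c \<noteq> a" "c \<noteq> b"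
      using disc_pegs_other by blast
    have "{a, b} \<noteq> {a, c}" "{a, b} \<noteq> {c, b}"
      using c by (auto simp: doubleton_eq_iff)
    then have "(u(Suc m := a), v(Suc m := c)) \<in> ?R\<^sup>*" "(v(Suc m := c), v(Suc m := b)) \<in> ?R\<^sup>*"
      using that c True via_other by auto
    then show ?thesis
      by (rule rtrancl_trans)
  next
    case False
    then show ?thesis
      using that via_other by blast
  qed
  obtain u a v b where uv: "u \<in> parity_hanoi_states m" "a \<in> disc_pegs (Suc m)" "s = u(Suc m := a)"
    "v \<in> parity_hanoi_states m" "b \<in> disc_pegs (Suc m)" "t = v(Suc m := b)"
    using Suc.prems by (metis parity_hanoi_states_SucE)
  show ?case
    unfolding uv(3,6) using copy[OF uv(1,4,2)] cross[OF uv(1,4,2,5)] by metis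
qed

lemma card_ge_2_if_disconnecting:
  assumes "finite F" "\<not> connected (with_proj (delete_edges (parity_hanoi_graph n) F))"
  shows "2 \<le> card F"
proof (rule ccontr)
  assume "\<not> 2 \<le> card F"
  then have "card F = 0 \<or> card F = 1"
    by linarith
  \<comment> \<open>For empty \<open>F\<close> any \<open>e\<close> will do, so both cardinalities
    are treated together.\<close>
  then obtain e where e: "F \<subseteq> {e}"
    using assms(1) by (auto simp: card_1_singleton_iff)
  have "hanoi_arcs_minus n e \<subseteq> {(s, t) \<in> parcs (parity_hanoi_graph n). {s, t} \<notin> F}"
    using e by (auto simp: hanoi_arcs_minus_def)
  then have "(s, t) \<in> {(s, t) \<in> parcs (parity_hanoi_graph n). {s, t} \<notin> F}\<^sup>*"
    if "s \<in> parity_hanoi_states n" "t \<in> parity_hanoi_states n" for s t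
    using parity_hanoi_bridgeless[OF that, of e] rtrancl_mono by blast
  moreover have "parity_hanoi_states n \<noteq> {}"
    using parity_hanoi_state_avoiding by blast
  ultimately have "connected (with_proj (delete_edges (parity_hanoi_graph n) F))"
    by (subst connected_delete_edges_iff[OF pair_graph_parity_hanoi_graph])
      (simp add: parity_hanoi_graph_def)
  then show False
    using assms(2) by contradiction
qed

text \<open>Disc 1 on peg 0 keeps every larger disc from leaving that peg. Disc 1 itself is odd, so
  its other pegs are 2 and 3.\<close>

lemma parity_hanoi_adj_all_zero:
  assumes "parity_hanoi_adj n (\<lambda>d\<in>{1..n}. 0) t" "t \<in> parity_hanoi_states n"
  shows "t = (\<lambda>d\<in>{1..n}. 0)(1 := 2) \<or> t = (\<lambda>d\<in>{1..n}. 0)(1 := 3)"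
proof -
  let ?z = "\<lambda>d\<in>{1..n}. 0::nat"
  obtain d where d: "d \<in> {1..n}" "t d \<in> disc_pegs d" "?z d \<noteq> t d"
    "\<forall>k\<in>{1..n} - {d}. ?z k = t k" "\<forall>k\<in>{1..<d}. ?z k \<notin> {?z d, t d}"
    using assms(1) unfolding parity_hanoi_adj_def by blast
  have "d = 1"
    using d(1,5) by (cases "d = 1") force+
  moreover have "t 1 \<in> {2, 3}"
    using d(1-3) \<open>d = 1\<close> by (auto simp: disc_pegs_def reserved_peg_def)
  moreover have "t = ?z(1 := t 1)"
  proof
    fix k
    show "t k = (?z(1 := t 1)) k"
      using d(4) assms(2) \<open>d = 1\<close>
      by (cases "k \<in> {1..n}") (auto simp: parity_hanoi_states_def PiE_iff extensional_def)
  qed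
  ultimately show ?thesis
    by auto
qed

theorem theorem6p10:
  fixes n :: nat
  assumes "n \<ge> 1"
  shows "edge_connectivity (parity_hanoi_graph n) = 2"
proof -
  let ?G = "parity_hanoi_graph n"
  let ?z = "\<lambda>d\<in>{1..n}. 0::nat"
  \<comment> \<open>The two edges at the all-zero state; deleting them isolates it.\<close>
  let ?F = "{{?z, ?z(1 := 2)}, {?z, ?z(1 := 3)}}"
  have z: "?z \<in> parity_hanoi_states n"
    by (auto simp: parity_hanoi_states_def disc_pegs_def)
  have upd: "?z(1 := p) \<in> parity_hanoi_states n \<and> parity_hanoi_adj n ?z (?z(1 := p))"
    if "p \<in> {2, 3}" for p
  proof
    have p: "p \<in> disc_pegs 1" "0 \<in> disc_pegs 1" "p \<noteq> 0"
      using that by (auto simp: disc_pegs_def reserved_peg_def)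
    then show "?z(1 := p) \<in> parity_hanoi_states n"
      using z assms by (auto simp: parity_hanoi_states_def PiE_iff extensional_def)
    show "parity_hanoi_adj n ?z (?z(1 := p))"
      unfolding parity_hanoi_adj_def using p assms
      by (intro bexI[of _ 1] bexI[of _ 0] bexI[of _ p]) auto
  qed
  \<comment> \<open>Since \<open>n \<ge> 1\<close>, the value \<open>?z 1\<close> is 0 and not
    \<open>undefined\<close>, hence differs from 2 and 3.\<close>
  have neq: "?z \<noteq> ?z(1 := 2)" "?z \<noteq> ?z(1 := 3)" "?z(1 := 2) \<noteq> ?z(1 := 3)"
    using assms by (auto simp: fun_eq_iff)
  have card: "card ?F = 2"
    using neq by (auto simp: doubleton_eq_iff)
  have "?F \<subseteq> edges ?G"
    using z upd unfolding edges_def parity_hanoi_graph_def by auto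
  moreover have "\<not> connected (with_proj (delete_edges ?G ?F))"
  proof
    let ?R = "{(s, t) \<in> parcs ?G. {s, t} \<notin> ?F}"
    assume "connected (with_proj (delete_edges ?G ?F))"
    then have "\<forall>s\<in>pverts ?G. \<forall>t\<in>pverts ?G. (s, t) \<in> ?R\<^sup>*"
      using connected_delete_edges_iff[OF pair_graph_parity_hanoi_graph] by blast
    then have "(?z, ?z(1 := 2)) \<in> ?R\<^sup>*"
      using z upd[of 2] by (simp add: parity_hanoi_graph_def)
    \<comment> \<open>A walk to a different state needs a first arc out of \<open>?z\<close>, but
      every such arc lies on an edge of \<open>?F\<close>.\<close>
    then obtain t where "(?z, t) \<in> ?R"
      using neq(1) by (meson converse_rtranclE)
    then show False
      using parity_hanoi_adj_all_zero[of n t] by (auto simp: parity_hanoi_graph_def)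
  qed
  ultimately have "edge_connectivity ?G = card ?F"
    using card card_ge_2_if_disconnecting by (intro edge_connectivity_eqI) auto
  then show ?thesis
    using card by simp
qed

end
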